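(* Let $G$ be a 3-connected 1-heavy graph on $n\geq 3$ vertices. Suppose that for every induced subgraph $H$ of $G$ isomorphic to $Z_1$ and every pair of vertices $u,v\in V(H)$ with $d_H(u,v)=2$, we have $\max\{d(u),d(v)\}\geq n/2$ or $|N(u)\cap N(v)|\geq 2$. Then $G$ is Hamiltonian.
   Context: All graphs are finite and simple; $d(x)$ and $N(x)$ denote the degree and neighborhood of $x$ in $G$, and $d_H(u,v)$ is the distance between $u$ and $v$ in $H$. A vertex of $G$ is heavy if its degree is at least $n/2$. A claw is $K_{1,3}$; its degree-3 vertex is the center and the other three are end-vertices. $G$ is 1-heavy if every induced claw of $G$ has at least one heavy end-vertex. $Z_1$ is the graph obtained from a triangle by attaching a pendant edge to one vertex of the triangle. *)

theory Defs
  imports "Graph_Theory.Graph_Theory"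
begin

text \<open>
  A finite simple graph is a \<^locale>\<open>pair_graph\<close>: a finite, loop-free, symmetric digraph
  whose arcs are pairs of vertices, each undirected edge being represented by its two orientations.
\<close>

definition nbhd :: "'a pair_pre_digraph \<Rightarrow> 'a \<Rightarrow> 'a set" where
  "nbhd G x = {y. x \<rightarrow>\<^bsub>with_proj G\<^esub> y}"

text \<open>Every undirected edge at \<open>x\<close> has exactly one orientation leaving \<open>x\<close>.\<close>

definition deg :: "'a pair_pre_digraph \<Rightarrow> 'a \<Rightarrow> nat" where
  "deg G x = out_degree (with_proj G) x"

lemma (in pair_graph) deg_eq_card_nbhd: "deg G x = card (nbhd G x)"
proof -
  have "out_arcs (with_proj G) x = Pair x ` nbhd G x"
    by (auto simp: out_arcs_def nbhd_def)
  then show ?thesis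
    by (simp add: deg_def out_degree_def card_image inj_on_def)
qed

text \<open>The infimum of the walk lengths; infinite when \<open>v\<close> is not reachable from \<open>u\<close>.\<close>

definition graph_dist :: "'a pair_pre_digraph \<Rightarrow> 'a \<Rightarrow> 'a \<Rightarrow> ereal" where
  "graph_dist G u v = wf_digraph.\<mu> (with_proj G) (\<lambda>_. 1) u v"

definition heavy :: "'a pair_pre_digraph \<Rightarrow> 'a \<Rightarrow> bool" where
  "heavy G x \<longleftrightarrow> real (deg G x) \<ge> real (card (pverts G)) / 2"

definition claw :: "'a pair_pre_digraph \<Rightarrow> bool" where
  "claw H \<longleftrightarrow> complete_bipartite_digraph 1 3 (with_proj H)"

definition claw_center :: "'a pair_pre_digraph \<Rightarrow> 'a \<Rightarrow> bool" where
  "claw_center H c \<longleftrightarrow> c \<in> pverts H \<and> deg H c = 3"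

definition claw_end_vertex :: "'a pair_pre_digraph \<Rightarrow> 'a \<Rightarrow> bool" where
  "claw_end_vertex H x \<longleftrightarrow> x \<in> pverts H \<and> \<not> claw_center H x"

definition one_heavy :: "'a pair_pre_digraph \<Rightarrow> bool" where
  "one_heavy G \<longleftrightarrow>
    (\<forall>H. induced_subgraph (with_proj H) (with_proj G) \<and> claw H \<longrightarrow>
      (\<exists>x. claw_end_vertex H x \<and> heavy G x))"

text \<open>The triangle \<open>0, 1, 2\<close> with the pendant edge from \<open>0\<close> to \<open>3\<close>.\<close>

definition Z1 :: "nat pair_pre_digraph" where
  "Z1 = (let E = {(0, 1), (1, 2), (2, 0), (0, 3)} in \<lparr> pverts = {0, 1, 2, 3}, parcs = E \<union> E\<inverse> \<rparr>)"

lemma pair_graph_Z1: "pair_graph Z1"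
  by unfold_locales (auto simp: Z1_def Let_def symmetric_def intro!: symI)

definition k_connected :: "nat \<Rightarrow> 'a pair_pre_digraph \<Rightarrow> bool" where
  "k_connected k G \<longleftrightarrow>
    k < card (pverts G) \<and>
    (\<forall>S \<subseteq> pverts G. card S < k \<longrightarrow> connected (with_proj G \<restriction> (pverts G - S)))"

text \<open>
  In a symmetric digraph the walk \<open>a, b, a\<close> along a single edge counts as a
  \<^const>\<open>pre_digraph.cycle\<close>; the length bound excludes it. The vertices of a cycle are the tails
  of its arcs.
\<close>

definition hamiltonian :: "'a pair_pre_digraph \<Rightarrow> bool" where
  "hamiltonian G \<longleftrightarrow>
    (\<exists>p. pre_digraph.cycle (with_proj G) p \<and> 3 \<le> length p \<and> fst ` set p = pverts G)"

end

(*
  Join any two heavy vertices. By the closure argument of Bondy and Chvatal it is enough to find a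
  spanning cycle in the graph F obtained in this way. Take a maximal cycle C of F through all
  heavy vertices and suppose that some component R of G - C is not empty. By 3-connectivity R has at
  least three neighbours on C. Their successors on C are pairwise non-adjacent in F, and so are their
  predecessors; as heavy vertices are adjacent in F, some neighbour x of R has neither a heavy
  successor nor a heavy predecessor. The claw at x forces these two to be adjacent, so with a vertex
  r of R they form a copy of Z1, which gives a second vertex y of C adjacent to r and to the successor
  of x. Repeating the argument at y, where exactly the successor is heavy, gives a third such vertex z,
  and in each case a rerouting of C passes through r as well, contradicting maximality.
*)
theory Submission
  imports Defs
begin

section \<open>Cycles and paths as vertex lists\<close>

text \<open>The list is read cyclically; the length bound rules out a single edge traversed back and
  forth.\<close>

definition cyc :: "('a \<Rightarrow> 'a \<Rightarrow> bool) \<Rightarrow> 'a list \<Rightarrow> bool" where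
  "cyc P xs \<longleftrightarrow> distinct xs \<and> 3 \<le> length xs \<and> successively P xs \<and> P (last xs) (hd xs)"

lemma cyc_rotate: "cyc P (xs @ ys) \<Longrightarrow> cyc P (ys @ xs)"
  by (cases "xs = []"; cases "ys = []") (auto simp: cyc_def successively_append_iff)

lemma cyc_rev: "symp P \<Longrightarrow> cyc P xs \<Longrightarrow> cyc P (rev xs)"
  by (auto simp: cyc_def successively_rev hd_rev last_rev symp_def elim: successively_mono)

text \<open>If the new first vertex already lies on the path built so far, only the part of that
  path from its occurrence onward is kept.\<close>

lemma path_of_rtranclp:
  assumes "S\<^sup>*\<^sup>* x y"
  shows "\<exists>p. p \<noteq> [] \<and> hd p = x \<and> last p = y \<and> distinct p \<and> successively S p"
  using assms
proof (induction rule: converse_rtranclp_induct)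
  case base
  show ?case by (intro exI[of _ "[y]"]) auto
next
  case (step x z)
  then obtain p where p: "p \<noteq> []" "hd p = z" "last p = y" "distinct p" "successively S p" by blast
  show ?case
  proof (cases "x \<in> set p")
    case True
    then obtain a b where "p = a @ x # b" by (auto simp: in_set_conv_decomp)
    then show ?thesis using p
      by (intro exI[of _ "x # b"]) (auto simp: successively_append_iff)
  next
    case False
    then show ?thesis using p step
      by (intro exI[of _ "x # p"]) (auto simp: successively_Cons)
  qed
qed

section \<open>A maximal cycle that misses a component\<close>

text \<open>
  \<open>W\<close> is the vertex set of a cycle that contains all heavy vertices \<open>H\<close>, has edges in \<open>E\<close> or inside
  \<open>H\<close>, and is maximal; \<open>R\<close> is a component of the rest of the graph.
\<close>

locale nonspanning_maximal_cycle =
  fixes V H W R :: "'a set" and E :: "'a \<Rightarrow> 'a \<Rightarrow> bool" and xs0 :: "'a list"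
  assumes E_sym: "E a b \<Longrightarrow> E b a"
    and W_V: "W \<subseteq> V"
    and R_V: "R \<subseteq> V"
    and RW: "R \<inter> W = {}"
    and RH: "R \<inter> H = {}"
    and R_path: "a \<in> R \<Longrightarrow> b \<in> R \<Longrightarrow>
      \<exists>p. p \<noteq> [] \<and> hd p = a \<and> last p = b \<and> distinct p \<and> set p \<subseteq> R \<and> successively E p"
    and R_closed: "a \<in> R \<Longrightarrow> E a b \<Longrightarrow> b \<in> R \<union> W"
    and maximal: "cyc (\<lambda>a b. E a b \<or> a \<noteq> b \<and> a \<in> H \<and> b \<in> H) ys \<Longrightarrow> set ys \<subseteq> V \<Longrightarrow> W \<subseteq> set ys \<Longrightarrow>
      set ys \<inter> R = {}"
    and claw_free: "E c a \<Longrightarrow> E c b \<Longrightarrow> E c d \<Longrightarrow> distinct [a, b, d] \<Longrightarrow>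
      a \<notin> H \<Longrightarrow> b \<notin> H \<Longrightarrow> d \<notin> H \<Longrightarrow> E a b \<or> E a d \<or> E b d"
    and common_nbr: "E c a \<Longrightarrow> E c b \<Longrightarrow> E a b \<Longrightarrow> E c d \<Longrightarrow> \<not> E d a \<Longrightarrow> \<not> E d b \<Longrightarrow>
      a \<notin> H \<Longrightarrow> d \<notin> H \<Longrightarrow> \<exists>z. z \<noteq> c \<and> E z a \<and> E z d"
    and attach3: "3 \<le> card {x \<in> W. \<exists>r\<in>R. E r x}"
    and cyc0: "cyc (\<lambda>a b. E a b \<or> a \<noteq> b \<and> a \<in> H \<and> b \<in> H) xs0" "set xs0 = W"
begin

definition F :: "'a \<Rightarrow> 'a \<Rightarrow> bool" where
  "F a b \<longleftrightarrow> E a b \<or> a \<noteq> b \<and> a \<in> H \<and> b \<in> H"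

text \<open>The attachments of \<open>R\<close> on the cycle; \<open>attach3\<close> supplies three
  of them.\<close>

definition T :: "'a set" where
  "T = {x \<in> W. \<exists>r\<in>R. E r x}"

definition W_cycle :: "'a list \<Rightarrow> bool" where
  "W_cycle xs \<longleftrightarrow> cyc F xs \<and> set xs = W"

lemma F_abs: "F = (\<lambda>a b. E a b \<or> a \<noteq> b \<and> a \<in> H \<and> b \<in> H)"
  by (auto simp: F_def fun_eq_iff)

lemma F_sym: "F a b \<Longrightarrow> F b a"
  using E_sym by (auto simp: F_def)

lemma EF: "E a b \<Longrightarrow> F a b"
  by (auto simp: F_def)

lemma F_E: "F a b \<Longrightarrow> a \<notin> H \<or> b \<notin> H \<Longrightarrow> E a b"
  by (auto simp: F_def)

lemma successively_F_flip [simp]: "successively (\<lambda>a b. F b a) xs = successively F xs"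
proof -
  have "(\<lambda>a b. F b a) = F" using F_sym by (auto simp: fun_eq_iff)
  then show ?thesis by (rule arg_cong)
qed

lemma successively_EF: "successively E p \<Longrightarrow> successively F p"
  by (erule successively_mono) (auto intro: EF)

lemma no_larger: "cyc F ys \<Longrightarrow> set ys \<subseteq> V \<Longrightarrow> W \<subseteq> set ys \<Longrightarrow> set ys \<inter> R = {}"
  using maximal F_abs by simp

lemma W_cycle_rotate: "W_cycle (xs @ ys) \<Longrightarrow> W_cycle (ys @ xs)"
  by (auto simp: W_cycle_def cyc_rotate)

lemma W_cycle_rotate_Cons: "W_cycle (x # xs @ y # ys) \<Longrightarrow> W_cycle (y # ys @ x # xs)"
  using W_cycle_rotate[of "x # xs" "y # ys"] by simp

text \<open>Reversal with \<open>x\<close> kept in front exchanges its successor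
  \<open>hd xs\<close> with its predecessor \<open>last xs\<close>, so facts about successors carry
  over to predecessors.\<close>

lemma W_cycle_rev_Cons: "W_cycle (x # xs) \<Longrightarrow> W_cycle (x # rev xs)"
  using cyc_rev[of F "x # xs"] W_cycle_rotate[of "rev xs" "[x]"]
  by (auto simp: W_cycle_def symp_def F_sym)

lemma W_cycle_rev2: "W_cycle (x # xs @ y # ys) \<Longrightarrow> W_cycle (x # rev ys @ y # rev xs)"
  using W_cycle_rev_Cons[of x "xs @ y # ys"] by simp

lemma W_cycle_ex: "x \<in> W \<Longrightarrow> \<exists>S. W_cycle (x # S)"
proof -
  assume "x \<in> W"
  then obtain a b where "xs0 = a @ x # b" using cyc0 by (auto simp: in_set_conv_decomp)
  then have "W_cycle (a @ x # b)" using cyc0 by (simp add: W_cycle_def F_abs)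
  from W_cycle_rotate[OF this] show ?thesis by auto
qed

text \<open>Connectedness of \<open>R\<close> yields a detour, possibly a single vertex, that can
  join two attachments in a rerouting.\<close>

lemma T_path:
  assumes "x \<in> T" "y \<in> T"
  obtains p where "p \<noteq> []" "distinct p" "set p \<subseteq> R" "successively F p" "F x (hd p)" "F (last p) y"
proof -
  obtain r s where "r \<in> R" "s \<in> R" "E r x" "E s y" using assms by (auto simp: T_def)
  moreover obtain p where "p \<noteq> []" "hd p = r" "last p = s" "distinct p" "set p \<subseteq> R" "successively E p"
    using R_path[OF \<open>r \<in> R\<close> \<open>s \<in> R\<close>] by blast
  ultimately show thesis using that[of p] E_sym EF successively_EF by blast
qed

lemma W_cycle_length: "W_cycle xs \<Longrightarrow> 3 \<le> length xs"
  by (simp add: W_cycle_def cyc_def)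

section \<open>Successors and predecessors of attachments\<close>

text \<open>A detour through \<open>R\<close> between \<open>x\<close> and its successor would
  enlarge the cycle.\<close>

lemma succ_notin_T:
  assumes o: "W_cycle (x # S)" and x: "x \<in> T"
  shows "S \<noteq> []" "hd S \<notin> T"
proof -
  show "S \<noteq> []" using W_cycle_length[OF o] by auto
  show "hd S \<notin> T"
  proof
    assume "hd S \<in> T"
    obtain p where p: "p \<noteq> []" "distinct p" "set p \<subseteq> R" "successively F p" "F x (hd p)" "F (last p) (hd S)"
      using T_path[OF x \<open>hd S \<in> T\<close>] by blast
    have "cyc F (x # p @ S)" using o p RW \<open>S \<noteq> []\<close>
      by (auto simp: W_cycle_def cyc_def successively_append_iff successively_Cons)
    moreover have "set (x # p @ S) \<subseteq> V" using o p R_V W_V by (auto simp: W_cycle_def)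
    moreover have "W \<subseteq> set (x # p @ S)" using o by (auto simp: W_cycle_def)
    ultimately have "set (x # p @ S) \<inter> R = {}" by (rule no_larger)
    then show False using p by (cases p) auto
  qed
qed

lemma pred_notin_T:
  assumes o: "W_cycle (x # S)" and x: "x \<in> T"
  shows "last S \<notin> T"
  using succ_notin_T[OF W_cycle_rev_Cons[OF o] x] by (simp add: hd_rev)

lemma parts_nonempty:
  assumes o: "W_cycle (x # S1 @ y # S2)" and "x \<in> T" "y \<in> T"
  shows "S1 \<noteq> []" "S2 \<noteq> []"
  using succ_notin_T[OF o \<open>x \<in> T\<close>] succ_notin_T[OF W_cycle_rotate_Cons[OF o] \<open>y \<in> T\<close>] assms by auto

text \<open>With such an edge the cycle can be rerouted: from \<open>x\<close> through
  \<open>R\<close> to \<open>y\<close>, back along \<open>S1\<close> to \<open>hd S1\<close>, across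
  to \<open>hd S2\<close>, and along \<open>S2\<close> to \<open>x\<close>.\<close>

lemma succs_indep:
  assumes o: "W_cycle (x # S1 @ y # S2)" and x: "x \<in> T" and y: "y \<in> T"
  shows "\<not> F (hd S1) (hd S2)"
proof
  assume F: "F (hd S1) (hd S2)"
  note ne = parts_nonempty[OF assms]
  obtain p where p: "p \<noteq> []" "distinct p" "set p \<subseteq> R" "successively F p" "F x (hd p)" "F (last p) y"
    using T_path[OF x y] by blast
  have "cyc F (x # p @ y # rev S1 @ S2)" using o p RW ne F
    by (auto simp: W_cycle_def cyc_def successively_append_iff successively_Cons hd_rev last_rev F_sym)
  moreover have "set (x # p @ y # rev S1 @ S2) \<subseteq> V" using o p R_V W_V by (auto simp: W_cycle_def)
  moreover have "W \<subseteq> set (x # p @ y # rev S1 @ S2)" using o by (auto simp: W_cycle_def)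
  ultimately have "set (x # p @ y # rev S1 @ S2) \<inter> R = {}" by (rule no_larger)
  then show False using p by (cases p) auto
qed

lemma preds_indep:
  assumes o: "W_cycle (x # S1 @ y # S2)" and x: "x \<in> T" and y: "y \<in> T"
  shows "\<not> F (last S1) (last S2)"
  using succs_indep[OF W_cycle_rev2[OF o] x y] by (auto simp: hd_rev F_sym)

text \<open>Two distinct heavy vertices are adjacent in \<open>F\<close>, which independence of the
  successors (predecessors) forbids.\<close>

lemma heavy_indep:
  assumes o: "W_cycle (x # S1 @ y # S2)" and x: "x \<in> T" and y: "y \<in> T"
  shows "hd S1 \<notin> H \<or> hd S2 \<notin> H" "last S1 \<notin> H \<or> last S2 \<notin> H"
proof -
  note ne = parts_nonempty[OF assms]
  have "hd S1 \<noteq> hd S2" "last S1 \<noteq> last S2" using o ne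
    by (auto simp: W_cycle_def cyc_def dest!: hd_in_set last_in_set)
      (metis disjoint_iff hd_in_set last_in_set ne)+
  then show "hd S1 \<notin> H \<or> hd S2 \<notin> H" "last S1 \<notin> H \<or> last S2 \<notin> H"
    using succs_indep[OF assms] preds_indep[OF assms] by (auto simp: F_def)
qed

text \<open>Among three attachments at most one has a heavy successor and at most one a heavy
  predecessor, so a third has neither.\<close>

lemma light_neighbours:
  "\<exists>x S. W_cycle (x # S) \<and> x \<in> T \<and> hd S \<notin> H \<and> last S \<notin> H"
proof -
  have "finite T" using cyc0 unfolding T_def by (metis (no_types, lifting) List.finite_set finite_subset mem_Collect_eq subsetI)
  obtain a b c where abc: "a \<in> T" "b \<in> T" "c \<in> T" "a \<noteq> b" "a \<noteq> c" "b \<noteq> c"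
  proof -
    have "3 \<le> card T" using attach3 by (simp add: T_def)
    then obtain X where "X \<subseteq> T" "card X = 3" using obtain_subset_with_card_n by blast
    then show thesis using that by (auto simp: card_3_iff)
  qed
  obtain S where S: "W_cycle (a # S)" using W_cycle_ex abc by (auto simp: T_def)
  then have "b \<in> set S" "c \<in> set S" using abc by (auto simp: W_cycle_def T_def)
  \<comment> \<open>After \<open>a\<close>, the vertices \<open>b\<close> and \<open>c\<close> may
    come in either order; \<open>b'\<close> and \<open>c'\<close> name them in cyclic order.\<close>
  then have "\<exists>S1 b' S2 c' S3. S = S1 @ b' # S2 @ c' # S3 \<and> b' \<in> T \<and> c' \<in> T"
  proof -
    obtain X Y where XY: "S = X @ b # Y" using \<open>b \<in> set S\<close> by (auto simp: in_set_conv_decomp)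
    then consider "c \<in> set X" | "c \<in> set Y" using abc \<open>c \<in> set S\<close> by auto
    then show ?thesis
    proof cases
      case 1
      then obtain P Q where "X = P @ c # Q" by (auto simp: in_set_conv_decomp)
      then have "S = P @ c # Q @ b # Y" using XY by simp
      then show ?thesis using abc by blast
    next
      case 2
      then obtain P Q where "Y = P @ c # Q" by (auto simp: in_set_conv_decomp)
      then have "S = X @ b # P @ c # Q" using XY by simp
      then show ?thesis using abc by blast
    qed
  qed
  then obtain S1 b' S2 c' S3 where d: "S = S1 @ b' # S2 @ c' # S3" and t: "b' \<in> T" "c' \<in> T" by blast
  have o1: "W_cycle (a # S1 @ b' # S2 @ c' # S3)" using S d by simp
  have o2: "W_cycle (b' # S2 @ c' # S3 @ a # S1)" using W_cycle_rotate_Cons[OF o1] by simp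
  have o3: "W_cycle (c' # S3 @ a # S1 @ b' # S2)" using W_cycle_rotate_Cons[OF o2] by simp
  have ne: "S1 \<noteq> []" "S2 \<noteq> []" "S3 \<noteq> []"
    using parts_nonempty(1)[OF o1] parts_nonempty(1)[OF o2] parts_nonempty(1)[OF o3] abc t by auto
  have "hd S1 \<notin> H \<or> hd S2 \<notin> H" "last S1 \<notin> H \<or> last S3 \<notin> H"
    using heavy_indep[OF o1] abc t ne by auto
  moreover have "hd S2 \<notin> H \<or> hd S3 \<notin> H" "last S2 \<notin> H \<or> last S1 \<notin> H"
    using heavy_indep[OF o2] abc t ne by auto
  moreover have "hd S3 \<notin> H \<or> hd S1 \<notin> H" "last S3 \<notin> H \<or> last S2 \<notin> H"
    using heavy_indep[OF o3] abc t ne by auto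
  ultimately consider "hd S1 \<notin> H" "last S3 \<notin> H" | "hd S2 \<notin> H" "last S1 \<notin> H" | "hd S3 \<notin> H" "last S2 \<notin> H"
    by blast
  then show ?thesis
  proof cases
    case 1
    then show ?thesis using o1 abc ne by (intro exI[of _ a] exI[of _ "S1 @ b' # S2 @ c' # S3"]) auto
  next
    case 2
    then show ?thesis using o2 t ne by (intro exI[of _ b'] exI[of _ "S2 @ c' # S3 @ a # S1"]) auto
  next
    case 3
    then show ?thesis using o3 t ne by (intro exI[of _ c'] exI[of _ "S3 @ a # S1 @ b' # S2"]) auto
  qed
qed

section \<open>The contradiction from inserting a vertex of R\<close>

text \<open>All remaining reroutings contradict maximality in this form: they keep \<open>W\<close>
  and add the one vertex \<open>r\<close>.\<close>

lemma no_insertion: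
  assumes "cyc F ys" "r \<in> R" "set ys = insert r W"
  shows False
  using no_larger[OF assms(1)] assms(2,3) R_V W_V by auto

lemma inconsistent: False
proof -
  obtain x S where oS: "W_cycle (x # S)" and x: "x \<in> T" and hS: "hd S \<notin> H" and lS: "last S \<notin> H"
    using light_neighbours by blast
  obtain r where r: "r \<in> R" "E r x" using x by (auto simp: T_def)
  have rW: "r \<notin> W" and rH: "r \<notin> H" using r RW RH by auto
  have nadj: "\<not> E r z" if "z \<in> W" "z \<notin> T" for z using that r by (auto simp: T_def)
  have Sne: "S \<noteq> []" and hT: "hd S \<notin> T" and lT: "last S \<notin> T"
    using succ_notin_T[OF oS x] pred_notin_T[OF oS x] by auto
  have hW: "hd S \<in> W" and lW: "last S \<in> W" and xW: "x \<in> W" using oS Sne by (auto simp: W_cycle_def)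
  have "length S \<ge> 2" using W_cycle_length[OF oS] by simp
  then have hl: "hd S \<noteq> last S" using oS by (cases S) (auto simp: W_cycle_def cyc_def)
  have Fx: "F x (hd S)" "F x (last S)" using oS Sne by (auto simp: W_cycle_def cyc_def successively_Cons F_sym)
  then have Ex: "E x (hd S)" "E x (last S)" using hS lS by (auto intro: F_E)
  have Exr: "E x r" using r E_sym by blast
  \<comment> \<open>The ends \<open>hd S\<close>, \<open>last S\<close> and \<open>r\<close> of the
    star at \<open>x\<close> are light, and \<open>r\<close> has no neighbour in \<open>W\<close>
    outside \<open>T\<close>, so only this edge can spoil the claw.\<close>
  have Ehl: "E (hd S) (last S)"
    using claw_free[OF Exr Ex] hl hW lW rW rH hS lS nadj hT lT by auto
  txt \<open>\<open>x\<close>, its two neighbours on the cycle and \<open>r\<close> induce a \<^const>\<open>Z1\<close>.\<close>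
  obtain y where y: "y \<noteq> x" "E y (hd S)" "E y r"
    using common_nbr[OF Ex(1) Ex(2) Ehl Exr] nadj hT lT hW lW hS rH by blast
  \<comment> \<open>Neighbours of \<open>r\<close> lie in \<open>R\<close> or \<open>W\<close>; were
    \<open>y\<close> in \<open>R\<close>, then \<open>hd S\<close> would be an attachment.\<close>
  have yW: "y \<in> W"
  proof (rule ccontr)
    assume "y \<notin> W"
    then have "y \<in> R" using R_closed[OF r(1) E_sym[OF y(3)]] by auto
    then show False using y hT hW by (auto simp: T_def)
  qed
  then have yT: "y \<in> T" using y r E_sym by (auto simp: T_def)
  have "y \<in> set S" using yW y oS by (auto simp: W_cycle_def)
  then obtain S1 S2 where SS: "S = S1 @ y # S2" by (auto simp: in_set_conv_decomp)
  have o: "W_cycle (x # S1 @ y # S2)" using oS SS by simp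
  note ne = parts_nonempty[OF o x yT]
  have hS1: "hd S = hd S1" and lS2: "last S = last S2" using SS ne by auto
  note hS = hS[unfolded hS1] and hT = hT[unfolded hS1] and hW = hW[unfolded hS1]
    and lS = lS[unfolded lS2] and lT = lT[unfolded lS2] and lW = lW[unfolded lS2]
    and Ex = Ex[unfolded hS1 lS2] and Ehl = Ehl[unfolded hS1 lS2] and y = y[unfolded hS1]
  note o' = W_cycle_rotate_Cons[OF o]
  have T1: "last S1 \<notin> T" "hd S2 \<notin> T"
    using pred_notin_T[OF o' yT] succ_notin_T[OF o' yT] ne by auto
  have W1: "last S1 \<in> W" "hd S2 \<in> W" using o ne by (auto simp: W_cycle_def)
  note unf = W_cycle_def cyc_def successively_append_iff successively_Cons hd_rev last_rev
  have Fy: "F y (last S1)" "F y (hd S2)"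
    using o ne by (auto simp: unf F_sym)
  have Fyr: "F y r" "F r y" "F x r" "F r x" using y r E_sym EF by blast+
  have disj: "set S1 \<inter> set S2 = {}" using o by (auto simp: unf)
  have Fy1: "F y (hd S1)" "F (hd S1) y" "F (hd S1) (last S2)" using y Ehl EF E_sym by blast+
  \<comment> \<open>Such an edge would allow the order \<open>x\<close>, \<open>r\<close>,
    \<open>y\<close>, \<open>S1\<close>, \<open>S2\<close>, since \<open>y\<close> is adjacent to
    \<open>hd S1\<close>.\<close>
  have n1: "\<not> F (last S1) (hd S2)"
  proof
    assume "F (last S1) (hd S2)"
    then have "cyc F (x # r # y # S1 @ S2)" using o ne Fyr Fy1 rW by (auto simp: unf F_sym)
    then show False by (rule no_insertion[OF _ r(1)]) (use o in \<open>auto simp: unf\<close>)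
  qed
  have Eyr: "E y r" by (rule y)
  have lne: "last S1 \<noteq> hd S2" using disj ne by (metis disjoint_iff hd_in_set last_in_set)
  have hne: "hd S1 \<noteq> hd S2" using disj ne by (metis disjoint_iff hd_in_set)
  \<comment> \<open>If \<open>hd S2\<close> were light, the claw at \<open>y\<close> with ends
    \<open>r\<close>, \<open>hd S1\<close>, \<open>hd S2\<close> would make the two successors
    adjacent, against \<open>succs_indep\<close>.\<close>
  have n2: "hd S2 \<in> H"
  proof (rule ccontr)
    assume h2: "hd S2 \<notin> H"
    have "last S1 \<in> H"
    proof (rule ccontr)
      assume "last S1 \<notin> H"
      then have "E (last S1) (hd S2)"
        using claw_free[OF Eyr F_E[OF Fy(1)] F_E[OF Fy(2)]] h2 lne rW W1 rH nadj T1 by auto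
      then show False using n1 EF by blast
    qed
    have "E (hd S1) (hd S2)"
      using claw_free[OF Eyr y(2) F_E[OF Fy(2)]] h2 hne rW W1 hW rH nadj T1 hT hS by auto
    then show False using succs_indep[OF o x yT] EF by blast
  qed
  \<comment> \<open>Otherwise \<open>last S1\<close> and \<open>hd S2\<close> would both be heavy,
    hence \<open>F\<close>-adjacent, against \<open>n1\<close>.\<close>
  have lS1: "last S1 \<notin> H"
    using n1 n2 lne by (auto simp: F_def)
  \<comment> \<open>The rerouting runs from \<open>x\<close> back through \<open>S1\<close>, crosses
    by the edge from \<open>hd S1\<close> to \<open>last S2\<close>, runs back through
    \<open>S2\<close> to \<open>y\<close>, and returns through \<open>r\<close>.\<close>
  have n3: "\<not> F x (last S1)"
  proof
    assume "F x (last S1)"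
    then have "cyc F (x # rev S1 @ rev S2 @ [y, r])" using o ne Fyr Fy1 rW by (auto simp: unf F_sym)
    then show False by (rule no_insertion[OF _ r(1)]) (use o in \<open>auto simp: unf\<close>)
  qed
  have hl1: "hd S1 \<noteq> last S1" using n3 Ex EF by auto
  have Eyl: "E y (last S1)" using F_E[OF Fy(1)] lS1 by simp
  \<comment> \<open>The same claw argument at \<open>y\<close>, now with the light ends
    \<open>r\<close>, \<open>last S1\<close> and \<open>hd S1\<close>.\<close>
  have E1: "E (last S1) (hd S1)"
    using claw_free[OF Eyr Eyl y(2)] hl1 rW W1 hW rH nadj T1 hT hS lS1 by auto
  txt \<open>A second \<^const>\<open>Z1\<close>, with centre \<open>y\<close>, provides a third vertex at which \<open>r\<close> can be inserted.\<close>
  obtain z where z: "z \<noteq> y" "E z (last S1)" "E z r"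
    using common_nbr[OF Eyl y(2) E1 Eyr] nadj T1 W1 hT hW lS1 rH by blast
  have zW: "z \<in> W"
  proof (rule ccontr)
    assume "z \<notin> W"
    then have "z \<in> R" using R_closed[OF r(1) E_sym[OF z(3)]] by auto
    then show False using z T1 W1 by (auto simp: T_def)
  qed
  then have zT: "z \<in> T" using z r E_sym by (auto simp: T_def)
  have Fz: "F z r" "F r z" "F z (last S1)" "F (last S1) z" using z E_sym EF by blast+
  have "z \<noteq> x" using n3 z EF by blast
  then have "z \<in> set S1 \<or> z \<in> set S2" using zW z o by (auto simp: W_cycle_def)
  then show False
  proof
    assume "z \<in> set S1"
    then obtain A B where AB: "S1 = A @ z # B" by (auto simp: in_set_conv_decomp)
    have oz: "W_cycle (x # A @ z # B @ y # S2)" using o AB by simp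
    have Ane: "A \<noteq> []" using parts_nonempty(1)[OF oz x zT] .
    have ozz: "W_cycle (z # B @ y # S2 @ x # A)" using W_cycle_rotate_Cons[OF oz] by simp
    have Bne: "B \<noteq> []" using parts_nonempty(1)[OF ozz zT yT] .
    \<comment> \<open>Of the successors of \<open>z\<close> and \<open>y\<close> at most one is
      heavy, and \<open>hd S2\<close> is.\<close>
    have hB: "hd B \<notin> H" using heavy_indep(1)[OF ozz zT yT] n2 ne by simp
    have hA: "hd A = hd S1" and lB: "last B = last S1" using AB Ane Bne by auto
    show False
    proof (cases "last A \<in> H")
      case True
      have "last A \<noteq> hd S2" using disj ne AB Ane by (metis disjoint_iff hd_in_set last_in_set Un_iff set_append)
      then have "F (hd S2) (last A)" using True n2 by (auto simp: F_def)
      \<comment> \<open>The new links are the heavy pair \<open>hd S2\<close>,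
        \<open>last A\<close>, the edges from \<open>y\<close> to \<open>hd A\<close> and from
        \<open>x\<close> and \<open>z\<close> to \<open>r\<close>.\<close>
      then have "cyc F (r # x # rev S2 @ rev A @ y # rev B @ [z])"
        using oz ne Ane Bne Fyr Fy1 Fz Fy rW hA lB by (auto simp: unf F_sym)
      then show False by (rule no_insertion[OF _ r(1)]) (use oz in \<open>auto simp: unf\<close>)
    next
      case False
      have Fzz: "F z (last A)" "F z (hd B)" using oz Ane Bne by (auto simp: unf F_sym)
      have "last A \<noteq> hd B" using last_in_set[OF Ane] hd_in_set[OF Bne] oz by (auto simp: W_cycle_def cyc_def)
      moreover have "last A \<notin> T" "hd B \<notin> T"
        using pred_notin_T[OF ozz zT] succ_notin_T[OF ozz zT] Ane Bne by auto
      moreover have "last A \<in> W" "hd B \<in> W" using oz Ane Bne by (auto simp: W_cycle_def)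
      \<comment> \<open>The claw at \<open>z\<close> with light ends \<open>r\<close>,
        \<open>last A\<close>, \<open>hd B\<close> lets the cycle bypass \<open>z\<close>, which is
        then reinserted with \<open>r\<close> between \<open>last S1\<close> and
        \<open>y\<close>.\<close>
      ultimately have "E (last A) (hd B)"
        using claw_free[OF z(3) F_E[OF Fzz(1)] F_E[OF Fzz(2)]] False hB rW rH nadj by auto
      then have "F (last A) (hd B)" by (rule EF)
      then have "cyc F (x # A @ B @ z # r # y # S2)"
        using oz ne Ane Bne Fyr Fy1 Fz Fy rW hA lB by (auto simp: unf F_sym)
      then show False by (rule no_insertion[OF _ r(1)]) (use oz in \<open>auto simp: unf\<close>)
    qed
  next
    assume "z \<in> set S2"
    then obtain A B where AB: "S2 = A @ z # B" by (auto simp: in_set_conv_decomp)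
    have oz: "W_cycle (x # S1 @ y # A @ z # B)" using o AB by simp
    have oy: "W_cycle (y # A @ z # B @ x # S1)" using W_cycle_rotate_Cons[OF oz] by simp
    have oz': "W_cycle (z # B @ x # S1 @ y # A)" using W_cycle_rotate_Cons[OF oy] by simp
    have Ane: "A \<noteq> []" using parts_nonempty(1)[OF oy yT zT] .
    have Bne: "B \<noteq> []" using parts_nonempty(1)[OF oz' zT x] .
    have hA: "hd A = hd S2" and lB: "last B = last S2" using AB Ane Bne by auto
    have hB: "hd B \<notin> H" using heavy_indep(1)[OF oy yT zT] n2 hA Ane Bne by simp
    have Fzz: "F z (hd B)" using oz Bne by (auto simp: unf)
    have "last S1 \<noteq> hd B" using disj AB ne Bne by (metis disjoint_iff hd_in_set last_in_set Un_iff set_append list.set_intros(2))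
    moreover have "hd B \<notin> T" using succ_notin_T[OF oz' zT] Bne by auto
    moreover have "hd B \<in> W" using oz Bne by (auto simp: W_cycle_def)
    \<comment> \<open>Here the claw at \<open>z\<close> has ends \<open>r\<close>,
      \<open>last S1\<close> and \<open>hd B\<close>; the edge obtained joins \<open>rev B\<close>
      to \<open>rev S1\<close> in the rerouting below.\<close>
    ultimately have "E (last S1) (hd B)"
      using claw_free[OF z(3) z(2) F_E[OF Fzz]] lS1 hB rW rH nadj T1 W1 by auto
    then have "F (last S1) (hd B)" by (rule EF)
    then have "cyc F (r # x # rev B @ rev S1 @ y # A @ [z])"
      using oz ne Ane Bne Fyr Fy1 Fz Fy rW hA lB by (auto simp: unf F_sym)
    then show False by (rule no_insertion[OF _ r(1)]) (use oz in \<open>auto simp: unf\<close>)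
  qed
qed

end

section \<open>Replacing heavy pairs by edges\<close>

text \<open>The pair closing the cycle is not counted; \<open>bondy_chvatal\<close> adds it
  separately.\<close>

fun defects :: "('a \<Rightarrow> 'a \<Rightarrow> bool) \<Rightarrow> 'a list \<Rightarrow> nat" where
  "defects P (x # y # zs) = (if P x y then 0 else 1) + defects P (y # zs)"
| "defects P _ = 0"

lemma defects_append:
  "xs \<noteq> [] \<Longrightarrow> ys \<noteq> [] \<Longrightarrow>
    defects P (xs @ ys) = defects P xs + (if P (last xs) (hd ys) then 0 else 1) + defects P ys"
proof (induction P xs rule: defects.induct)
  case ("2_2" P x)
  then show ?case by (cases ys) auto
qed auto

lemma defects_rev: "symp P \<Longrightarrow> defects P (rev xs) = defects P xs"
proof (induction P xs rule: defects.induct)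
  case (1 P x y zs)
  then show ?case using defects_append[of "rev zs @ [y]" "[x]" P] by (auto dest: sympD)
qed auto

text \<open>Pigeonhole: neighbours of the first vertex, shifted back by one position, and neighbours
  of the last vertex occupy \<open>length xs - 1\<close> positions, fewer than the degree sum, so
  two of them coincide.\<close>

lemma ore_crossing:
  assumes d: "distinct xs" and ne: "xs \<noteq> []"
    and nE: "\<not> E (last xs) (hd xs)" "\<not> E (hd xs) (hd xs)" "\<not> E (last xs) (last xs)"
    and nb: "\<And>a. {y. E a y} \<subseteq> set xs"
    and deg: "length xs \<le> card {y. E (hd xs) y} + card {y. E (last xs) y}"
  shows "\<exists>A B. xs = A @ B \<and> A \<noteq> [] \<and> B \<noteq> [] \<and> E (hd xs) (hd B) \<and> E (last xs) (last A)"
proof -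
  define n where "n = length xs"
  define I where "I = {i. i < n - 1 \<and> E (hd xs) (xs ! Suc i)}"
  define J where "J = {i. i < n - 1 \<and> E (last xs) (xs ! i)}"
  have n: "n > 0" using ne by (simp add: n_def)
  have "{y. E (hd xs) y} = (\<lambda>i. xs ! Suc i) ` I"
  proof (intro equalityI subsetI)
    fix y assume y: "y \<in> {y. E (hd xs) y}"
    then obtain j where j: "j < n" "y = xs ! j" using nb by (metis in_set_conv_nth n_def subsetD)
    have "j \<noteq> 0" using y nE j ne by (metis hd_conv_nth mem_Collect_eq)
    then obtain i where "j = Suc i" by (cases j) auto
    then show "y \<in> (\<lambda>i. xs ! Suc i) ` I" using j y by (auto simp: I_def)
  qed (auto simp: I_def)
  then have cI: "card {y. E (hd xs) y} = card I"
    using d by (auto intro!: card_image inj_onI simp: I_def n_def nth_eq_iff_index_eq)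
  have "{y. E (last xs) y} = (\<lambda>i. xs ! i) ` J"
  proof (intro equalityI subsetI)
    fix y assume y: "y \<in> {y. E (last xs) y}"
    then obtain j where j: "j < n" "y = xs ! j" using nb by (metis in_set_conv_nth n_def subsetD)
    have "j \<noteq> n - 1" using y nE j ne by (metis last_conv_nth mem_Collect_eq n_def)
    then show "y \<in> (\<lambda>i. xs ! i) ` J" using j y by (auto simp: J_def)
  qed (auto simp: J_def)
  then have cJ: "card {y. E (last xs) y} = card J"
    using d by (auto intro!: card_image inj_onI simp: J_def n_def nth_eq_iff_index_eq)
  have "I \<inter> J \<noteq> {}"
  proof
    assume "I \<inter> J = {}"
    moreover have fin: "finite I" "finite J" by (auto simp: I_def J_def)
    ultimately have "card (I \<union> J) = card I + card J" by (rule card_Un_disjoint[rotated 2])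
    moreover have "card (I \<union> J) \<le> card {..<n - 1}" by (rule card_mono) (auto simp: I_def J_def)
    ultimately show False using deg cI cJ n unfolding n_def card_lessThan by linarith
  qed
  then obtain i where i: "i < n - 1" "E (hd xs) (xs ! Suc i)" "E (last xs) (xs ! i)"
    by (auto simp: I_def J_def)
  show ?thesis
  proof (intro exI conjI)
    show "xs = take (Suc i) xs @ drop (Suc i) xs" by simp
    show "take (Suc i) xs \<noteq> []" "drop (Suc i) xs \<noteq> []" using i ne by (auto simp: n_def)
    show "E (hd xs) (hd (drop (Suc i) xs))" using i by (simp add: hd_drop_conv_nth n_def)
    show "E (last xs) (last (take (Suc i) xs))" using i by (simp add: take_Suc_conv_app_nth n_def)
  qed
qed

text \<open>The cut shows where to rotate a cycle so that a missing edge becomes its closing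
  pair.\<close>

lemma defects_split:
  assumes "\<not> successively P xs"
  shows "\<exists>A B. xs = A @ B \<and> A \<noteq> [] \<and> B \<noteq> [] \<and> \<not> P (last A) (hd B)"
  using assms
proof (induction P xs rule: defects.induct)
  case (1 P x y zs)
  show ?case
  proof (cases "P x y")
    case True
    then obtain A B where "y # zs = A @ B" "A \<noteq> []" "B \<noteq> []" "\<not> P (last A) (hd B)" using 1 by auto
    then show ?thesis by (intro exI[of _ "x # A"] exI[of _ B]) auto
  next
    case False
    then show ?thesis by (intro exI[of _ "[x]"] exI[of _ "y # zs"]) auto
  qed
qed auto

text \<open>
  Bondy--Chvatal: a spanning cycle with the fewest edges outside \<open>E\<close> has none, as such an
  edge could be exchanged for edges of \<open>E\<close> by Ore's crossing argument.
\<close>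

lemma bondy_chvatal:
  assumes sym: "symp E" and irr: "irreflp E" and nb: "\<And>a. {y. E a y} \<subseteq> V"
    and PE: "\<And>a b. P a b \<longleftrightarrow> E a b \<or> a \<noteq> b \<and> a \<in> H \<and> b \<in> H"
    and deg: "\<And>a b. a \<in> H \<Longrightarrow> b \<in> H \<Longrightarrow> card V \<le> card {y. E a y} + card {y. E b y}"
  shows "cyc P xs \<Longrightarrow> set xs = V \<Longrightarrow> \<exists>ys. cyc E ys \<and> set ys = V"
proof (induction "defects E xs + (if E (last xs) (hd xs) then 0 else 1)" arbitrary: xs rule: less_induct)
  case less
  have symP: "symp P" using sym by (auto simp: PE symp_def)
  show ?case
  proof (cases "successively E xs \<and> E (last xs) (hd xs)")
    case True
    then show ?thesis using less.prems by (auto simp: cyc_def)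
  next
    case False
    \<comment> \<open>Rotation leaves the cyclic number of defects unchanged; the \<open>+ 1\<close>
      is the defect now at the closing pair.\<close>
    have "\<exists>ys. cyc P ys \<and> set ys = V \<and> \<not> E (last ys) (hd ys) \<and>
      defects E ys + 1 = defects E xs + (if E (last xs) (hd xs) then 0 else 1)"
    proof (cases "E (last xs) (hd xs)")
      case True
      with False obtain A B where AB: "xs = A @ B" "A \<noteq> []" "B \<noteq> []" "\<not> E (last A) (hd B)"
        using defects_split by blast
      then show ?thesis using less.prems True
        by (intro exI[of _ "B @ A"]) (auto simp: defects_append cyc_rotate)
    next
      case False
      then show ?thesis using less.prems by auto
    qed
    then obtain ys where ys: "cyc P ys" "set ys = V" "\<not> E (last ys) (hd ys)"
      and b: "defects E ys + 1 = defects E xs + (if E (last xs) (hd xs) then 0 else 1)" by blast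
    have ne: "ys \<noteq> []" and d: "distinct ys" using ys by (auto simp: cyc_def)
    have "last ys \<in> H" "hd ys \<in> H" using ys by (auto simp: cyc_def PE)
    then have "length ys \<le> card {y. E (hd ys) y} + card {y. E (last ys) y}"
      using deg ys d distinct_card by metis
    then obtain A B where AB: "ys = A @ B" "A \<noteq> []" "B \<noteq> []" "E (hd ys) (hd B)" "E (last ys) (last A)"
      using ore_crossing[where E = E, OF d ne ys(3)] nb ys irr by (auto simp: irreflp_def)
    \<comment> \<open>The closing pair and the link between \<open>A\<close> and \<open>B\<close>
      are exchanged for two edges of \<open>E\<close>, so the total drops.\<close>
    let ?zs = "A @ rev B"
    have E1: "E (hd B) (hd A)" "E (last A) (last B)" using AB sym by (auto dest: sympD)
    then have P1: "P (hd B) (hd A)" "P (last A) (last B)" by (auto simp: PE)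
    have "cyc P ?zs"
      using ys(1) AB(1-3) P1 symP
      by (auto simp: cyc_def successively_append_iff hd_rev last_rev elim!: successively_mono dest: sympD)
    moreover have "set ?zs = V" using ys AB by auto
    moreover have "defects E ?zs + (if E (last ?zs) (hd ?zs) then 0 else 1) \<le> defects E ys"
      using AB(1-3) E1 by (auto simp: defects_append defects_rev[OF sym] last_rev hd_rev)
    ultimately show ?thesis using less.hyps[of ?zs] b by auto
  qed
qed

section \<open>An initial cycle through all heavy vertices\<close>

text \<open>
  With at most two heavy vertices, a path avoiding \<open>u\<close> from another neighbour of \<open>u\<close> to \<open>v\<close>
  closes up to a cycle through both; with more of them, the heavy vertices themselves form a cycle
  of \<open>P\<close>.
\<close>

lemma cycle_through_heavy:
  assumes sym: "symp E" and irr: "irreflp E" and fin: "finite V" and card: "3 < card V"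
    and EV: "\<And>a b. E a b \<Longrightarrow> b \<in> V" and HV: "H \<subseteq> V"
    and conn: "\<And>S x y. card S < 3 \<Longrightarrow> S \<subseteq> V \<Longrightarrow> x \<in> V - S \<Longrightarrow> y \<in> V - S \<Longrightarrow>
      (\<lambda>a b. E a b \<and> a \<notin> S \<and> b \<notin> S)\<^sup>*\<^sup>* x y"
    and PE: "\<And>a b. P a b \<longleftrightarrow> E a b \<or> a \<noteq> b \<and> a \<in> H \<and> b \<in> H"
  shows "\<exists>xs. cyc P xs \<and> H \<subseteq> set xs \<and> set xs \<subseteq> V"
proof -
  have finH: "finite H" using HV fin finite_subset by blast
  \<comment> \<open>Some vertex other than \<open>u\<close> survives the deletion of
    \<open>S\<close>; the first step of a path towards it is the neighbour.\<close>
  have nbr: "\<exists>w. E u w \<and> w \<notin> S" if "u \<in> V" "u \<notin> S" "card S < 3" "S \<subseteq> V" for u S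
  proof -
    have "\<not> V \<subseteq> insert u S"
    proof
      assume "V \<subseteq> insert u S"
      then have "card V \<le> card (insert u S)" using that fin by (intro card_mono) (auto intro: finite_subset)
      also have "\<dots> \<le> Suc (card S)" by (simp add: card_insert_le_m1 card_insert_if)
      finally show False using card that by simp
    qed
    then obtain y where "y \<in> V - S" "y \<noteq> u" by auto
    then have "(\<lambda>a b. E a b \<and> a \<notin> S \<and> b \<notin> S)\<^sup>*\<^sup>* u y" using conn[of S u y] that by auto
    then show ?thesis using \<open>y \<noteq> u\<close> by (cases rule: converse_rtranclpE) auto
  qed
  have main: "\<exists>xs. cyc P xs \<and> {u, v} \<subseteq> set xs \<and> set xs \<subseteq> V" if uv: "u \<in> V" "v \<in> V" "u \<noteq> v" "P u v" for u v
  proof -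
    obtain w where w: "E u w" "w \<noteq> v" using nbr[of u "{v}"] uv by auto
    have "w \<in> V" "w \<noteq> u" using w EV irr by (auto simp: irreflp_def)
    then have "(\<lambda>a b. E a b \<and> a \<notin> {u} \<and> b \<notin> {u})\<^sup>*\<^sup>* w v" using conn[of "{u}" w v] uv by auto
    from path_of_rtranclp[OF this] obtain p where
      p: "p \<noteq> []" "hd p = w" "last p = v" "distinct p" "successively (\<lambda>a b. E a b \<and> a \<notin> {u} \<and> b \<notin> {u}) p"
      by blast
    \<comment> \<open>As \<open>w\<close> differs from \<open>v\<close>, the path has two vertices,
      and with \<open>u\<close> the cycle has at least three.\<close>
    have len: "2 \<le> length p"
    proof (rule ccontr)
      assume "\<not> 2 \<le> length p"
      moreover have "0 < length p" using p(1) by simp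
      ultimately have "length p = 1" by linarith
      then show False using p w by (auto simp: length_Suc_conv)
    qed
    have sub: "set q \<subseteq> V - {u}" if "q \<noteq> []" "hd q \<in> V - {u}" "successively (\<lambda>a b. E a b \<and> a \<notin> {u} \<and> b \<notin> {u}) q" for q
      using that
    proof (induction q)
      case (Cons a q)
      then show ?case using EV by (cases "q = []") (auto simp: successively_Cons)
    qed simp
    have pV: "set p \<subseteq> V - {u}" using sub[OF p(1)] p \<open>w \<in> V\<close> \<open>w \<noteq> u\<close> by auto
    have sP: "successively P p" using p(5) by (rule successively_mono) (auto simp: PE)
    have "P v u" using uv PE sym by (auto dest: sympD)
    then have "cyc P (u # p)" using p len pV sP w by (auto simp: cyc_def successively_Cons PE)
    moreover have "{u, v} \<subseteq> set (u # p)" using p by (auto intro: last_in_set)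
    ultimately show ?thesis using pV uv by (intro exI[of _ "u # p"]) auto
  qed
  show ?thesis
  proof (cases "3 \<le> card H")
    case True
    obtain xs where xs: "set xs = H" "distinct xs" using finite_distinct_list[OF finH] by blast
    have suc: "successively P ys" if "set ys \<subseteq> H" "distinct ys" for ys
      using that by (induction ys) (auto simp: successively_Cons PE)
    have len: "3 \<le> length xs" using xs True distinct_card by metis
    then have "xs \<noteq> []" by auto
    then have "last xs \<noteq> hd xs" using len xs by (cases xs) auto
    then have "P (last xs) (hd xs)" using xs \<open>xs \<noteq> []\<close> by (auto simp: PE)
    then have "cyc P xs" using xs len suc by (auto simp: cyc_def)
    then show ?thesis using xs HV by blast
  next
    case False
    then consider "card H = 2" | "card H \<le> 1" by linarith
    then show ?thesis
    proof cases
      case 1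
      then obtain u v where "H = {u, v}" "u \<noteq> v" by (auto simp: card_2_iff)
      then show ?thesis using main[of u v] HV PE by auto
    next
      case 2
      then obtain u where u: "u \<in> V" "H \<subseteq> {u}"
      proof (cases "H = {}")
        case True
        moreover obtain u where "u \<in> V" using card by fastforce
        ultimately show thesis using that by auto
      next
        case False
        then have "card H = 1" using 2 finH by (simp add: le_Suc_eq)
        then obtain u where "H = {u}" by (auto simp: card_1_singleton_iff)
        then show thesis using that[of u] HV by auto
      qed
      \<comment> \<open>With at most one heavy vertex, any edge at a vertex \<open>u\<close>
        covering \<open>H\<close> can play the part of the heavy pair.\<close>
      obtain v where "E u v" using nbr[of u "{}"] u by auto
      then have "u \<noteq> v" "v \<in> V" "P u v" using EV irr PE by (auto simp: irreflp_def)
      then show ?thesis using main[of u v] u by blast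
    qed
  qed
qed

section \<open>The combinatorial core\<close>

text \<open>The heavy vertices enter only as a set \<open>H\<close> with large degree sums, and the
  claw and \<open>Z1\<close> conditions only as \<open>claw_free\<close> and
  \<open>common_nbr\<close>. A longest \<open>P\<close>-cycle through \<open>H\<close> must be
  spanning, and \<open>bondy_chvatal\<close> then turns it into a cycle of \<open>E\<close>.\<close>

lemma spanning_cycle:
  assumes sym: "symp E" and irr: "irreflp E" and fin: "finite V" and card: "3 < card V"
    and EV: "\<And>a b. E a b \<Longrightarrow> b \<in> V" and HV: "H \<subseteq> V"
    and conn: "\<And>S x y. card S < 3 \<Longrightarrow> S \<subseteq> V \<Longrightarrow> x \<in> V - S \<Longrightarrow> y \<in> V - S \<Longrightarrow>
      (\<lambda>a b. E a b \<and> a \<notin> S \<and> b \<notin> S)\<^sup>*\<^sup>* x y"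
    and deg: "\<And>a b. a \<in> H \<Longrightarrow> b \<in> H \<Longrightarrow> card V \<le> card {y. E a y} + card {y. E b y}"
    and claw_free: "\<And>a b c d. E c a \<Longrightarrow> E c b \<Longrightarrow> E c d \<Longrightarrow> distinct [a, b, d] \<Longrightarrow>
      a \<notin> H \<Longrightarrow> b \<notin> H \<Longrightarrow> d \<notin> H \<Longrightarrow> E a b \<or> E a d \<or> E b d"
    and common_nbr: "\<And>a b c d. E c a \<Longrightarrow> E c b \<Longrightarrow> E a b \<Longrightarrow> E c d \<Longrightarrow> \<not> E d a \<Longrightarrow> \<not> E d b \<Longrightarrow>
      a \<notin> H \<Longrightarrow> d \<notin> H \<Longrightarrow> \<exists>z. z \<noteq> c \<and> E z a \<and> E z d"
  shows "\<exists>xs. cyc E xs \<and> set xs = V"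
proof -
  define P where "P a b \<longleftrightarrow> E a b \<or> a \<noteq> b \<and> a \<in> H \<and> b \<in> H" for a b
  define Q where "Q xs \<longleftrightarrow> cyc P xs \<and> H \<subseteq> set xs \<and> set xs \<subseteq> V" for xs
  have "\<exists>xs. Q xs" unfolding Q_def by (rule cycle_through_heavy[OF sym irr fin card EV HV conn P_def])
  moreover have "\<forall>xs. Q xs \<longrightarrow> card (set xs) < Suc (card V)"
    by (auto simp: Q_def less_Suc_eq_le fin card_mono)
  ultimately obtain xs where xs: "Q xs" and max: "\<And>ys. Q ys \<Longrightarrow> card (set ys) \<le> card (set xs)"
    using ex_has_greatest_nat[of Q _ "\<lambda>xs. card (set xs)" "Suc (card V)"] by (metis less_le)
  have "set xs = V"
  proof (rule ccontr)
    assume "set xs \<noteq> V"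
    then obtain r0 where r0: "r0 \<in> V" "r0 \<notin> set xs" using xs by (auto simp: Q_def)
    define S where "S a b \<longleftrightarrow> E a b \<and> a \<notin> set xs \<and> b \<notin> set xs" for a b
    \<comment> \<open>The component of \<open>r0\<close> in the graph outside the cycle.\<close>
    define R where "R = {y. S\<^sup>*\<^sup>* r0 y}"
    have symS: "symp S\<^sup>*\<^sup>*" using sym by (intro symp_rtranclp) (auto simp: S_def symp_def)
    have RV: "y \<in> V - set xs" if "y \<in> R" for y
    proof -
      have "S\<^sup>*\<^sup>* r0 y" using that by (simp add: R_def)
      then show ?thesis using r0 EV by (induction rule: rtranclp_induct) (auto simp: S_def)
    qed
    have closed: "b \<in> R \<union> set xs" if "a \<in> R" "E a b" for a b
    proof (cases "b \<in> set xs")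
      case False
      then have "S a b" using that RV by (auto simp: S_def)
      then show ?thesis using that by (auto simp: R_def intro: rtranclp.rtrancl_into_rtrancl)
    qed auto
    define T where "T = {x \<in> set xs. \<exists>r\<in>R. E r x}"
    interpret nonspanning_maximal_cycle V H "set xs" R E xs
    proof
      show "E b a" if "E a b" for a b using sym that by (rule sympD)
      show "set xs \<subseteq> V" using xs by (simp add: Q_def)
      show "R \<subseteq> V" "R \<inter> set xs = {}" using RV by auto
      then show "R \<inter> H = {}" using xs by (auto simp: Q_def)
      show "\<exists>p. p \<noteq> [] \<and> hd p = a \<and> last p = b \<and> distinct p \<and> set p \<subseteq> R \<and> successively E p"
        if "a \<in> R" "b \<in> R" for a b
      proof -
        have "S\<^sup>*\<^sup>* a b" using that symS by (auto simp: R_def dest: sympD intro: rtranclp_trans)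
        from path_of_rtranclp[OF this] obtain p where
          p: "p \<noteq> []" "hd p = a" "last p = b" "distinct p" "successively S p" by blast
        have "set q \<subseteq> R" if "q \<noteq> []" "hd q \<in> R" "successively S q" for q
          using that
        proof (induction q)
          case (Cons a q)
          then show ?case
            by (cases "q = []") (auto simp: successively_Cons R_def intro: rtranclp.rtrancl_into_rtrancl)
        qed simp
        then have "set p \<subseteq> R" using p that by auto
        moreover have "successively E p" using p(5) by (rule successively_mono) (auto simp: S_def)
        ultimately show ?thesis using p by blast
      qed
      show "b \<in> R \<union> set xs" if "a \<in> R" "E a b" for a b using closed that .
      show "set ys \<inter> R = {}"
        if "cyc (\<lambda>a b. E a b \<or> a \<noteq> b \<and> a \<in> H \<and> b \<in> H) ys" "set ys \<subseteq> V" "set xs \<subseteq> set ys" for ys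
      proof -
        have "cyc P ys" using that(1) by (simp add: P_def[abs_def])
        then have "card (set ys) \<le> card (set xs)" using xs that by (intro max) (auto simp: Q_def)
        \<comment> \<open>Maximality is in the number of vertices, so a cycle covering
          \<open>set xs\<close> has exactly these vertices.\<close>
        then have "set xs = set ys" using that(3) by (intro card_seteq) auto
        then show ?thesis using RV by auto
      qed
      show "cyc (\<lambda>a b. E a b \<or> a \<noteq> b \<and> a \<in> H \<and> b \<in> H) xs" using xs by (simp add: Q_def P_def[abs_def])
      show "3 \<le> card {x \<in> set xs. \<exists>r\<in>R. E r x}"
      \<comment> \<open>Fewer than three attachments would separate \<open>r0\<close> from some
        \<open>y\<close> on the cycle: a walk from \<open>r0\<close> that avoids \<open>T\<close>
        never leaves \<open>R\<close>.\<close>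
      proof (rule ccontr)
        assume "\<not> 3 \<le> card {x \<in> set xs. \<exists>r\<in>R. E r x}"
        then have cT: "card T < 3" by (simp add: T_def)
        have "3 \<le> card (set xs)" using xs by (simp add: Q_def cyc_def distinct_card)
        then have "T \<noteq> set xs" using cT by auto
        then obtain y where y: "y \<in> set xs" "y \<notin> T" by (auto simp: T_def)
        have "(\<lambda>a b. E a b \<and> a \<notin> T \<and> b \<notin> T)\<^sup>*\<^sup>* r0 y"
          using xs y r0 by (intro conn cT) (auto simp: Q_def T_def)
        then have "y \<in> R"
        proof (induction rule: rtranclp_induct)
          case base
          show ?case by (simp add: R_def)
        next
          case (step a b)
          then show ?case using closed[of a b] by (auto simp: T_def)
        qed
        then show False using RV y by auto
      qed
    qed (use claw_free common_nbr in blast)+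
    show False by (rule inconsistent)
  qed
  then show ?thesis using bondy_chvatal[OF sym irr _ P_def deg, where xs = xs] EV xs by (auto simp: Q_def)
qed

section \<open>Induced claws and induced copies of Z1\<close>

definition induced_on :: "'a pair_pre_digraph \<Rightarrow> 'a set \<Rightarrow> 'a pair_pre_digraph" where
  "induced_on G X = \<lparr> pverts = X, parcs = parcs G \<inter> X \<times> X \<rparr>"

lemma induced_on_simps [simp]:
  "pverts (induced_on G X) = X" "parcs (induced_on G X) = parcs G \<inter> X \<times> X"
  by (simp_all add: induced_on_def)

lemma nbhd_iff: "y \<in> nbhd G x \<longleftrightarrow> (x, y) \<in> parcs G"
  by (simp add: nbhd_def)

context pair_graph
begin

lemma parcs_sym: "(a, b) \<in> parcs G \<Longrightarrow> (b, a) \<in> parcs G"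
  using pair_sym_arcs by (auto simp: symmetric_def dest: symD)

lemma parcs_irrefl: "(a, a) \<notin> parcs G"
  using pair_no_loops by force

lemma parcs_verts: "(a, b) \<in> parcs G \<Longrightarrow> a \<in> pverts G \<and> b \<in> pverts G"
  using in_arcsD1 in_arcsD2 by blast

lemma pair_graph_induced_on:
  assumes "X \<subseteq> pverts G"
  shows "pair_graph (induced_on G X)"
proof
  show "finite (pverts (induced_on G X))"
    using assms pair_finite_verts by (simp add: finite_subset)
  show "finite (parcs (induced_on G X))" using pair_finite_arcs by simp
  show "symmetric (with_proj (induced_on G X))"
    using parcs_sym by (auto simp: symmetric_def intro!: symI)
qed (use parcs_irrefl in auto)

lemma induced_subgraph_induced_on:
  assumes "X \<subseteq> pverts G"
  shows "induced_subgraph (with_proj (induced_on G X)) (with_proj G)"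
proof -
  interpret H: pair_graph "induced_on G X" using assms by (rule pair_graph_induced_on)
  show ?thesis using assms
    by (auto simp: induced_subgraph_def subgraph_def compatible_def
        wf_digraph_axioms H.wf_digraph_axioms)
qed

text \<open>The four vertices induce a claw; its heavy end-vertex cannot be \<open>c\<close>, which
  has degree 3 there.\<close>

lemma one_heavy_claw:
  assumes oh: "one_heavy G"
    and E: "(c, a) \<in> parcs G" "(c, b) \<in> parcs G" "(c, d) \<in> parcs G" and d: "distinct [a, b, d]"
    and nE: "(a, b) \<notin> parcs G" "(a, d) \<notin> parcs G" "(b, d) \<notin> parcs G"
  shows "heavy G a \<or> heavy G b \<or> heavy G d"
proof -
  let ?X = "{c, a, b, d}"
  let ?H = "induced_on G ?X"
  have sub: "?X \<subseteq> pverts G" using E parcs_verts by auto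
  interpret H: pair_graph ?H using sub by (rule pair_graph_induced_on)
  have nc: "c \<noteq> a" "c \<noteq> b" "c \<noteq> d" using E parcs_irrefl by auto
  have nE': "(b, a) \<notin> parcs G" "(d, a) \<notin> parcs G" "(d, b) \<notin> parcs G" using nE parcs_sym by auto
  have arcs: "parcs ?H = {c} \<times> {a, b, d} \<union> {a, b, d} \<times> {c}"
    using E E[THEN parcs_sym] nE nE' parcs_irrefl by auto
  have "claw ?H"
    unfolding claw_def complete_bipartite_digraph_pair_def
  proof (rule conjI[OF H.pair_finite_verts], rule exI[of _ "{c}"], rule exI[of _ "{a, b, d}"], intro conjI)
    show "parcs ?H = {c} \<times> {a, b, d} \<union> {a, b, d} \<times> {c}" by (rule arcs)
  qed (use nc d in auto)
  moreover have "induced_subgraph (with_proj ?H) (with_proj G) \<and> claw ?H \<longrightarrow>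
      (\<exists>x. claw_end_vertex ?H x \<and> heavy G x)"
    using oh unfolding one_heavy_def by (rule spec)
  ultimately obtain x where x: "claw_end_vertex ?H x" "heavy G x"
    using induced_subgraph_induced_on[OF sub] by auto
  have "nbhd ?H c = {a, b, d}"
    using nc by (auto simp: nbhd_iff arcs simp del: induced_on_simps(2))
  then have "deg ?H c = 3" using H.deg_eq_card_nbhd d by simp
  then have "x \<noteq> c" "x \<in> ?X" using x by (auto simp: claw_end_vertex_def claw_center_def)
  then show ?thesis using x by auto
qed

text \<open>The walk through \<open>w\<close> has cost 2, and a shorter one would force
  \<open>u = v\<close> or an arc from \<open>u\<close> to \<open>v\<close>.\<close>

lemma graph_dist_2:
  assumes "(u, w) \<in> parcs G" "(w, v) \<in> parcs G" "(u, v) \<notin> parcs G" "u \<noteq> v"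
  shows "graph_dist G u v = 2"
proof -
  have awalk: "awalk u [(u, w), (w, v)] v" using assms parcs_verts by (auto simp: awalk_def)
  have "(INF p\<in>{p. awalk u p v}. ereal (awalk_cost (\<lambda>_. 1) p)) = ereal 2"
  proof (rule INF_eqI)
    fix p assume "p \<in> {p. awalk u p v}"
    then have p: "awalk u p v" by simp
    have "2 \<le> length p"
    proof (rule ccontr)
      assume "\<not> 2 \<le> length p"
      then have "length p = 0 \<or> length p = 1" by linarith
      then show False using p assms by (auto simp: awalk_def length_Suc_conv)
    qed
    then show "ereal 2 \<le> ereal (awalk_cost (\<lambda>_. 1) p)"
      by (simp add: awalk_cost_def sum_list_triv)
  next
    fix z assume "\<And>p. p \<in> {p. awalk u p v} \<Longrightarrow> z \<le> ereal (awalk_cost (\<lambda>_. 1) p)"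
    from this[of "[(u, w), (w, v)]"] awalk show "z \<le> ereal 2" by simp
  qed
  then show ?thesis by (simp add: graph_dist_def \<mu>_def)
qed

text \<open>In the \<open>Z1\<close> induced by the four vertices, \<open>a\<close> and the pendant
  vertex \<open>d\<close> are at distance 2. Both are light, so they have two common neighbours, one
  of them other than \<open>c\<close>.\<close>

lemma Z1_common_nbr:
  assumes Z: "\<And>K u v.
      induced_subgraph (with_proj K) (with_proj G) \<Longrightarrow>
      digraph_iso (with_proj K) (with_proj Z1) \<Longrightarrow>
      u \<in> pverts K \<Longrightarrow> v \<in> pverts K \<Longrightarrow> graph_dist K u v = 2 \<Longrightarrow>
      heavy G u \<or> heavy G v \<or> card (nbhd G u \<inter> nbhd G v) \<ge> 2"
    and E: "(c, a) \<in> parcs G" "(c, b) \<in> parcs G" "(a, b) \<in> parcs G" "(c, d) \<in> parcs G"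
    and nE: "(d, a) \<notin> parcs G" "(d, b) \<notin> parcs G"
    and light: "\<not> heavy G a" "\<not> heavy G d"
  shows "\<exists>z. z \<noteq> c \<and> (z, a) \<in> parcs G \<and> (z, d) \<in> parcs G"
proof -
  let ?X = "{c, a, b, d}"
  let ?H = "induced_on G ?X"
  have sub: "?X \<subseteq> pverts G" using E parcs_verts by auto
  interpret H: pair_graph ?H using sub by (rule pair_graph_induced_on)
  have ne: "c \<noteq> a" "c \<noteq> b" "c \<noteq> d" "a \<noteq> b" "a \<noteq> d" "b \<noteq> d"
    using E nE parcs_irrefl parcs_sym by auto
  have nE': "(a, d) \<notin> parcs G" "(b, d) \<notin> parcs G" using nE parcs_sym by auto
  have arcs: "parcs ?H = {(c, a), (a, c), (c, b), (b, c), (a, b), (b, a), (c, d), (d, c)}"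
    using E E[THEN parcs_sym] nE nE' parcs_irrefl by auto
  \<comment> \<open>The default value 3 is the label of the pendant vertex \<open>d\<close>.\<close>
  define f where "f x = (if x = c then 0 else if x = a then 1 else if x = b then 2 else 3 :: nat)" for x
  have f: "f c = 0" "f a = 1" "f b = 2" "f d = 3" using ne by (auto simp: f_def)
  define iso where "iso = \<lparr> iso_verts = f, iso_arcs = map_prod f f, iso_head = snd, iso_tail = fst \<rparr>"
  have inj: "inj_on f ?X" using f by (auto simp: inj_on_def)
  then have "inj_on (map_prod f f) (?X \<times> ?X)" by (intro map_prod_inj_on)
  then have inj2: "inj_on (map_prod f f) (parcs ?H)" by (rule inj_on_subset) auto
  have "pre_digraph.digraph_isomorphism (with_proj ?H) iso"
    unfolding pre_digraph.digraph_isomorphism_def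
    using H.wf_digraph_axioms inj inj2 by (simp add: iso_def)
  moreover have "with_proj Z1 = app_iso iso (with_proj ?H)"
  proof -
    have "map_prod f f ` parcs ?H = parcs Z1"
      unfolding arcs by (auto simp: f Z1_def Let_def)
    moreover have "f ` pverts ?H = pverts Z1" by (auto simp: f Z1_def Let_def)
    ultimately show ?thesis by (simp add: app_iso_def iso_def with_proj_def)
  qed
  ultimately have iso: "digraph_iso (with_proj ?H) (with_proj Z1)"
    unfolding digraph_iso_def by blast
  have "graph_dist ?H a d = 2" by (rule H.graph_dist_2[of a c]) (use arcs ne in auto)
  then have "card (nbhd G a \<inter> nbhd G d) \<ge> 2"
    using Z[OF induced_subgraph_induced_on[OF sub] iso, of a d] light by auto
  then have "\<not> nbhd G a \<inter> nbhd G d \<subseteq> {c}"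
    using card_mono[of "{c}" "nbhd G a \<inter> nbhd G d"] by auto
  then obtain z where "z \<noteq> c" "z \<in> nbhd G a" "z \<in> nbhd G d" by blast
  then show ?thesis using parcs_sym unfolding nbhd_iff by blast
qed

section \<open>Translating connectivity and cycles\<close>

text \<open>\<open>connected\<close> speaks of the symmetric closure, which adds no arcs since
  \<open>G\<close> is symmetric.\<close>

lemma connected_rtranclp:
  assumes conn: "connected (with_proj G \<restriction> (pverts G - S))"
    and xy: "x \<in> pverts G - S" "y \<in> pverts G - S"
  shows "(\<lambda>a b. (a, b) \<in> parcs G \<and> a \<notin> S \<and> b \<notin> S)\<^sup>*\<^sup>* x y"
proof -
  let ?M = "mk_symmetric (with_proj G \<restriction> (pverts G - S))"
  have "(x, y) \<in> rtrancl_on (verts ?M) (arcs_ends ?M)"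
    using conn xy by (simp add: connected_def strongly_connected_def reachable_def)
  then have "(x, y) \<in> (arcs_ends ?M)\<^sup>*" by (rule rtrancl_on_rtranclI)
  moreover have "arcs_ends ?M \<subseteq> {(a, b). (a, b) \<in> parcs G \<and> a \<notin> S \<and> b \<notin> S}"
    by (auto simp: parcs_mk_symmetric dest: parcs_sym)
  ultimately have "(x, y) \<in> {(a, b). (a, b) \<in> parcs G \<and> a \<notin> S \<and> b \<notin> S}\<^sup>*"
    using rtrancl_mono by blast
  then show ?thesis unfolding Enum.rtranclp_rtrancl_eq .
qed

text \<open>A free endpoint \<open>v\<close> makes the induction on the list possible; the cycle is
  the case where \<open>v\<close> is the head.\<close>

lemma cas_zip_rotate:
  "xs \<noteq> [] \<Longrightarrow> pcas (hd xs) (zip xs (tl xs @ [v])) v"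
proof (induction xs)
  case (Cons x xs)
  then show ?case by (cases xs) auto
qed simp

lemma hamiltonian_of_cyc:
  assumes c: "cyc (\<lambda>a b. (a, b) \<in> parcs G) xs" and V: "set xs = pverts G"
  shows "hamiltonian G"
proof -
  have len: "3 \<le> length xs" and d: "distinct xs" using c by (auto simp: cyc_def)
  then have ne: "xs \<noteq> []" by auto
  \<comment> \<open>Each vertex is paired with its cyclic successor, which yields the arcs of the
    cycle.\<close>
  define p where "p = zip xs (tl xs @ [hd xs])"
  have lp: "length (tl xs @ [hd xs]) = length xs" using ne by simp
  have fst: "map fst p = xs" and snd: "map snd p = tl xs @ [hd xs]"
    unfolding p_def using lp by (simp_all add: map_fst_zip map_snd_zip)
  have suc: "successively (\<lambda>a b. (a, b) \<in> parcs G) xs \<Longrightarrow> (last xs, v) \<in> parcs G \<Longrightarrow> xs \<noteq> [] \<Longrightarrow>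
    set (zip xs (tl xs @ [v])) \<subseteq> parcs G" for v xs
  proof (induction xs)
    case (Cons x xs)
    then show ?case by (cases xs) auto
  qed simp
  have cas: "pcas (hd xs) p (hd xs)" unfolding p_def using ne by (rule cas_zip_rotate)
  then have "awalk (hd xs) p (hd xs)"
    using suc[of xs "hd xs"] c ne V by (auto simp: awalk_def p_def cyc_def)
  moreover have "p \<noteq> []" using fst ne by auto
  \<comment> \<open>Without its first entry the vertex sequence is \<open>tl xs @ [hd xs]\<close>, a
    rotation of \<open>xs\<close>.\<close>
  moreover have "distinct (tl (pawalk_verts (hd xs) p))"
  proof -
    have "pawalk_verts (hd xs) p = fst (hd p) # map snd p"
      using awalk_verts_conv'[OF cas] \<open>p \<noteq> []\<close> by simp
    then show ?thesis using snd d ne by (cases xs) auto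
  qed
  ultimately have "cycle p" unfolding cycle_def by blast
  moreover have "length p = length xs" using fst by (metis length_map)
  moreover have "fst ` set p = pverts G" using fst V by (metis set_map)
  ultimately show ?thesis using len unfolding hamiltonian_def by auto
qed

end

theorem theorem11:
  fixes G :: "'a pair_pre_digraph" and n :: nat
  assumes "pair_graph G"
    and "n = card (pverts G)"
    and "n \<ge> 3"
    and "k_connected 3 G"
    and "one_heavy G"
    and "\<And>H u v.
      induced_subgraph (with_proj H) (with_proj G) \<Longrightarrow>
      digraph_iso (with_proj H) (with_proj Z1) \<Longrightarrow>
      u \<in> pverts H \<Longrightarrow> v \<in> pverts H \<Longrightarrow> graph_dist H u v = 2 \<Longrightarrow>
      real (max (deg G u) (deg G v)) \<ge> real n / 2 \<or> card (nbhd G u \<inter> nbhd G v) \<ge> 2"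
  shows "hamiltonian G"
proof -
  interpret pair_graph G by fact
  let ?E = "\<lambda>a b. (a, b) \<in> parcs G"
  let ?H = "{x \<in> pverts G. heavy G x}"
  have nb: "{y. ?E a y} = nbhd G a" for a by (auto simp: nbhd_iff)
  have "\<exists>xs. cyc ?E xs \<and> set xs = pverts G"
  proof (rule spanning_cycle)
    show "symp ?E" by (rule sympI) (rule parcs_sym)
    show "irreflp ?E" by (auto intro: irreflpI simp: parcs_irrefl)
    show "finite (pverts G)" by (rule pair_finite_verts)
    show "3 < card (pverts G)" using assms(4) by (simp add: k_connected_def)
    show "b \<in> pverts G" if "?E a b" for a b using that parcs_verts by blast
    show "?H \<subseteq> pverts G" by blast
    show "(\<lambda>a b. ?E a b \<and> a \<notin> S \<and> b \<notin> S)\<^sup>*\<^sup>* x y"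
      if "card S < 3" "S \<subseteq> pverts G" "x \<in> pverts G - S" "y \<in> pverts G - S" for S x y
      using assms(4) that by (intro connected_rtranclp) (auto simp: k_connected_def)
    show "card (pverts G) \<le> card {y. ?E a y} + card {y. ?E b y}" if "a \<in> ?H" "b \<in> ?H" for a b
      using that unfolding nb deg_eq_card_nbhd[symmetric] by (simp add: heavy_def)
    \<comment> \<open>Ends of arcs are vertices, so lying outside \<open>?H\<close> means not being
      heavy.\<close>
    show "?E a b \<or> ?E a d \<or> ?E b d"
      if "?E c a" "?E c b" "?E c d" "distinct [a, b, d]" "a \<notin> ?H" "b \<notin> ?H" "d \<notin> ?H" for a b c d
      using one_heavy_claw[OF assms(5) that(1-4)] that parcs_verts by blast
    show "\<exists>z. z \<noteq> c \<and> ?E z a \<and> ?E z d"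
      if "?E c a" "?E c b" "?E a b" "?E c d" "\<not> ?E d a" "\<not> ?E d b" "a \<notin> ?H" "d \<notin> ?H" for a b c d
    proof (rule Z1_common_nbr[OF _ that(1-6)])
      show "\<not> heavy G a" "\<not> heavy G d" using that parcs_verts by blast+
      show "heavy G u \<or> heavy G v \<or> card (nbhd G u \<inter> nbhd G v) \<ge> 2"
        if "induced_subgraph (with_proj K) (with_proj G)" "digraph_iso (with_proj K) (with_proj Z1)"
          "u \<in> pverts K" "v \<in> pverts K" "graph_dist K u v = 2" for K u v
        using assms(6)[OF that] assms(2) by (auto simp: heavy_def max_def split: if_splits)
    qed
  qed
  then show ?thesis using hamiltonian_of_cyc by blast
qed

end
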